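(* Let $N\ge 2$, let $c_1,\dots,c_N>0$ be waiting-cost rates, and let $f:\mathbb{Z}_+^N\to\mathbb{R}_+$ be a matching-cost function such that $0<f(\mathbf{x})<\infty$ for all $\mathbf{x}\in\mathcal F:=\{\mathbf{x}\in\mathbb{Z}_+^N:\min_i x_i\ge 1\}$ and $f(\mathbf{x})\le f(\mathbf{y})$ whenever $\mathbf{x},\mathbf{y}\in\mathcal F$ and $\mathbf{x}\succeq\mathbf{y}$ componentwise. Consider any finite balanced complete-tuple instance with $K$ arrivals of each type. Then, for every $\alpha>0$, the Cost-Balancing algorithm $CB_\alpha$ satisfies $$J^{CB_\alpha}\le\left(1+\max\left\{\alpha,\tfrac{1}{\alpha}\right\}\right)J^{OPT}.$$ In particular, $J^{CB_1}\le 2J^{OPT}$.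
   Context: **Model.** There are $N\ge2$ agent types. Agents of each type arrive over continuous time $t\ge 0$ (arbitrary arrival times, finitely many in any finite interval). The state $\mathbf{X}(t)\in\mathbb{Z}_+^N$ records the number of unmatched agents of each type; the system starts empty. A type-$i$ arrival changes the state by $\mathbf{X}\leftarrow\mathbf{X}+\mathbf{e}_i$. A match (of one complete tuple, one agent of each type) is feasible iff $\mathbf{X}\in\mathcal F=\{\mathbf{x}\in\mathbb{Z}_+^N:\min_i x_i\ge1\}$, and changes the state by $\mathbf{X}\leftarrow\mathbf{X}-\mathbf{1}$. A policy may execute matches at any calendar times (several matches at one time are allowed). Events are processed one at a time; simultaneous arrivals are processed in an arbitrary but fixed order and a policy may re-evaluate its decision after each individual arrival. **Costs.** The waiting-cost rate in state $\mathbf{x}$ is $w(\mathbf{x})=\sum_{i=1}^N c_ix_i$. The $k$-th match of policy $\pi$, executed at time $\tau_k^\pi$, costs $f(\mathbf{Y}_k^\pi)$, where $\mathbf{Y}_k^\pi$ is the state on which that decision is made (after the arrivals processed so far, before the tuple is removed). **Finite balanced instance.** The finite arrival sequence contains exactly $K$ arrivals of each type, for some integer $K$. Every policy must execute all $K$ matches; otherwise its cost is $+\infty$. If it does, $$J^\pi=\int_0^{\tau_K^\pi}w(\mathbf{X}^\pi(t))\,dt+\sum_{k=1}^K f(\mathbf{Y}_k^\pi).$$ $J^{OPT}$ is the minimum total cost over offline policies that know the whole arrival sequence in advance. **The policy $CB_\alpha$ ($\alpha>0$).** Let $W$ denote the waiting cost $\int w(\mathbf{X}(s))\,ds$ accumulated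 since the previous match (since time $0$ before the first match); $W$ is reset to $0$ after each match. In current state $\mathbf{x}$: if $\mathbf{x}\notin\mathcal F$, wait for the next arrival (while $W$ keeps accumulating) and process it; if $\mathbf{x}\in\mathcal F$ and $f(\mathbf{x})\le\alpha W$, match one tuple immediately and reset $W$; if $\mathbf{x}\in\mathcal F$ and $f(\mathbf{x})>\alpha W$, set a timer of length $(f(\mathbf{x})/\alpha-W)/w(\mathbf{x})$ (the time at which $f(\mathbf{x})=\alpha W$ would hold absent arrivals); if the timer expires before the next arrival, match one tuple and reset $W$; otherwise discard the timer, process the arrival, and re-evaluate. If a timer and an arrival occur at the same calendar time, the timer is processed first. The procedure repeats until no arrivals remain and $\mathbf{x}\notin\mathcal F$. *)

theory Defs
  imports "HOL-Analysis.Analysis"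
begin

text \<open>
  Agent types are the elements of a finite type; a state counts the unmatched agents of each type.
  An instance is the list of arrivals (time, type), listed in the order in which they are processed;
  this order also resolves simultaneous arrivals.
\<close>

type_synonym 'n state = "'n \<Rightarrow> nat"
type_synonym 'n arrival_seq = "(real \<times> 'n) list"

datatype 'n action = Arrival 'n | Match

text \<open>
  The behaviour of a policy on an instance is recorded as the list of all timed events, arrivals and
  matches, in processing order. The position of a match in this list says which of the
  arrivals at the same calendar time precede it.
\<close>

type_synonym 'n trajectory = "(real \<times> 'n action) list"

definition feasible_states :: "'n state set" where
  "feasible_states = {x. \<forall>i. 1 \<le> x i}"

definition add_agent :: "'n \<Rightarrow> 'n state \<Rightarrow> 'n state" where
  "add_agent i x = x(i := x i + 1)"

definition remove_tuple :: "'n state \<Rightarrow> 'n state" where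
  "remove_tuple x = (\<lambda>i. x i - 1)"

fun act :: "'n action \<Rightarrow> 'n state \<Rightarrow> 'n state" where
  "act (Arrival i) x = add_agent i x"
| "act Match x = remove_tuple x"

definition state_after :: "'n trajectory \<Rightarrow> 'n state" where
  "state_after es = fold (\<lambda>e. act (snd e)) es (\<lambda>_. 0)"

text \<open>All events at times \<open>\<le> t\<close> have taken effect.\<close>

definition state_at :: "'n trajectory \<Rightarrow> real \<Rightarrow> 'n state" where
  "state_at es t = state_after (filter (\<lambda>e. fst e \<le> t) es)"

definition waiting_rate :: "('n::finite \<Rightarrow> real) \<Rightarrow> 'n state \<Rightarrow> real" where
  "waiting_rate c x = (\<Sum>i\<in>UNIV. c i * real (x i))"

definition balanced_instance :: "nat \<Rightarrow> 'n arrival_seq \<Rightarrow> bool" where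
  "balanced_instance K arr \<longleftrightarrow>
     sorted (map fst arr) \<and> (\<forall>a\<in>set arr. 0 \<le> fst a) \<and>
     (\<forall>i. length (filter (\<lambda>a. snd a = i) arr) = K)"

definition arrivals :: "'n trajectory \<Rightarrow> 'n arrival_seq" where
  "arrivals es = List.map_filter
     (\<lambda>e. case snd e of Arrival i \<Rightarrow> Some (fst e, i) | Match \<Rightarrow> None) es"

definition match_positions :: "'n trajectory \<Rightarrow> nat set" where
  "match_positions es = {j. j < length es \<and> snd (es ! j) = Match}"

definition last_match_time :: "'n trajectory \<Rightarrow> real" where
  "last_match_time es =
     (if match_positions es = {} then 0 else fst (es ! Max (match_positions es)))"

text \<open>
  A policy knowing the whole instance in advance may produce any trajectory that processes
  exactly the given arrivals and matches only in feasible states.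
\<close>

definition offline_trajectory :: "'n arrival_seq \<Rightarrow> 'n trajectory \<Rightarrow> bool" where
  "offline_trajectory arr es \<longleftrightarrow>
     sorted (map fst es) \<and> (\<forall>e\<in>set es. 0 \<le> fst e) \<and> arrivals es = arr \<and>
     (\<forall>j\<in>match_positions es. state_after (take j es) \<in> feasible_states)"

definition total_cost ::
  "('n::finite \<Rightarrow> real) \<Rightarrow> ('n state \<Rightarrow> real) \<Rightarrow> nat \<Rightarrow> 'n trajectory \<Rightarrow> ereal" where
  "total_cost c f K es =
     (if card (match_positions es) = K
      then ereal (integral {0..last_match_time es} (\<lambda>t. waiting_rate c (state_at es t))
                  + (\<Sum>j\<in>match_positions es. f (state_after (take j es))))
      else \<infinity>)"

text \<open>
  The infimum is a minimum: for a fixed interleaving of arrivals and matches it is cheapest to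
  execute every match at the time of the last arrival before it, and there are only finitely
  many interleavings.
\<close>

definition opt_cost ::
  "('n::finite \<Rightarrow> real) \<Rightarrow> ('n state \<Rightarrow> real) \<Rightarrow> nat \<Rightarrow> 'n arrival_seq \<Rightarrow> ereal" where
  "opt_cost c f K arr = (INF es\<in>{es. offline_trajectory arr es}. total_cost c f K es)"

text \<open>
  The arguments \<open>t\<close>, \<open>W\<close>, \<open>x\<close> and the list are the current time, the waiting cost accumulated since the
  previous match, the current state and the arrivals still to come. Since the state is constant
  between events, \<open>W\<close> grows by \<open>waiting_rate c x * (u - t)\<close> until the next arrival at time \<open>u\<close>.
\<close>

function cb_from ::
  "('n::finite \<Rightarrow> real) \<Rightarrow> ('n state \<Rightarrow> real) \<Rightarrow> real \<Rightarrow>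
   real \<Rightarrow> real \<Rightarrow> 'n state \<Rightarrow> 'n arrival_seq \<Rightarrow> 'n trajectory" where
  "cb_from c f \<alpha> t W x arr =
     (if x \<in> feasible_states then
        if f x \<le> \<alpha> * W then (t, Match) # cb_from c f \<alpha> t 0 (remove_tuple x) arr
        else
          (let s = t + (f x / \<alpha> - W) / waiting_rate c x in
           case arr of
             [] \<Rightarrow> (s, Match) # cb_from c f \<alpha> s 0 (remove_tuple x) []
           | (u, i) # rest \<Rightarrow>
               if s \<le> u then (s, Match) # cb_from c f \<alpha> s 0 (remove_tuple x) arr
               else (u, Arrival i) #
                 cb_from c f \<alpha> u (W + waiting_rate c x * (u - t)) (add_agent i x) rest)
      else
        (case arr of
           [] \<Rightarrow> []
         | (u, i) # rest \<Rightarrow>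
             (u, Arrival i) #
               cb_from c f \<alpha> u (W + waiting_rate c x * (u - t)) (add_agent i x) rest))"
  by pat_completeness auto

lemma sum_add_agent: "sum (add_agent i x) UNIV = Suc (sum x (UNIV :: 'n::finite set))"
proof -
  have "sum (add_agent i x) UNIV = (\<Sum>j\<in>UNIV. x j + (if j = i then 1 else 0))"
    by (rule sum.cong) (auto simp: add_agent_def)
  then show ?thesis
    by (simp add: sum.distrib)
qed

lemma sum_remove_tuple:
  fixes x :: "'n::finite state"
  assumes "x \<in> feasible_states"
  shows "sum (remove_tuple x) UNIV < sum x UNIV"
  using assms
  by (intro sum_strict_mono) (auto simp: remove_tuple_def feasible_states_def Suc_le_eq)

termination
  by (relation "Wellfounded.measure (\<lambda>(c, f, \<alpha>, t, W, x, arr). 2 * length arr + sum x UNIV)")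
    (auto simp: sum_add_agent dest: sum_remove_tuple)

declare cb_from.simps [simp del]

definition cost_balancing ::
  "('n::finite \<Rightarrow> real) \<Rightarrow> ('n state \<Rightarrow> real) \<Rightarrow> real \<Rightarrow> 'n arrival_seq \<Rightarrow> 'n trajectory" where
  "cost_balancing c f \<alpha> arr = cb_from c f \<alpha> 0 0 (\<lambda>_. 0) arr"

end

theory Submission
  imports Defs
begin

text \<open>
  Run \<open>CB\<^sub>\<alpha>\<close> and an arbitrary offline run side by side and charge each match of \<open>CB\<^sub>\<alpha>\<close>, together
  with the waiting cost \<open>W\<close> of the cycle that it ends, to the offline run; always \<open>f \<le> \<alpha> W\<close> at the match.
  If the offline run has not executed its \<open>k\<close>-th match before \<open>CB\<^sub>\<alpha>\<close> does, it holds at least as many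
  agents throughout the \<open>k\<close>-th cycle, so its waiting cost there is at least \<open>W\<close>, and the charge is
  at most \<open>(1 + \<alpha>) W\<close>. Otherwise its \<open>k\<close>-th match was made on a smaller state, at a cost
  \<open>f' \<ge> f\<close>; as \<open>CB\<^sub>\<alpha>\<close> has not matched since, also \<open>\<alpha> W \<le> f'\<close>, and the charge is at most
  \<open>(1 + 1 / \<alpha>) f'\<close>.
\<close>

section \<open>Recursive form of runs and costs\<close>

text \<open>The start time and state are parameters so that a run can be cut at any event and
  induction goes along its remainder.\<close>

fun valid_run :: "real \<Rightarrow> 'n state \<Rightarrow> 'n trajectory \<Rightarrow> bool" where
  "valid_run t x [] \<longleftrightarrow> True"
| "valid_run t x ((u, a) # es) \<longleftrightarrow>
     t \<le> u \<and> (a = Match \<longrightarrow> x \<in> feasible_states) \<and> valid_run u (act a x) es"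

fun run_cost ::
  "('n::finite \<Rightarrow> real) \<Rightarrow> ('n state \<Rightarrow> real) \<Rightarrow> real \<Rightarrow> 'n state \<Rightarrow> 'n trajectory \<Rightarrow> real" where
  "run_cost c f t x [] = 0"
| "run_cost c f t x ((u, a) # es) =
     waiting_rate c x * (u - t) + (if a = Match then f x else 0) + run_cost c f u (act a x) es"

abbreviation final_state :: "'n state \<Rightarrow> 'n trajectory \<Rightarrow> 'n state" where
  "final_state x es \<equiv> fold (\<lambda>e. act (snd e)) es x"

lemma remove_tuple_Suc: "x \<in> feasible_states \<Longrightarrow> Suc (remove_tuple x i) = x i"
  by (simp add: feasible_states_def remove_tuple_def Suc_le_eq)

lemma match_positions_Nil [simp]: "match_positions [] = {}"
  by (simp add: match_positions_def)

lemma match_positions_Cons: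
  "match_positions (e # es) = (if snd e = Match then {0} else {}) \<union> Suc ` match_positions es"
  by (auto simp: match_positions_def less_Suc_eq_0_disj nth_Cons')

lemma finite_match_positions [simp]: "finite (match_positions es)"
  by (simp add: match_positions_def)

lemma card_match_positions_Cons:
  "card (match_positions (e # es)) = (if snd e = Match then 1 else 0) + card (match_positions es)"
  by (auto simp: match_positions_Cons card_image card_insert_if)

lemma sum_match_positions_Cons:
  "(\<Sum>j\<in>match_positions (e # es). h j) =
     (if snd e = Match then h 0 else 0) + (\<Sum>j\<in>match_positions es. h (Suc j))"
  by (auto simp: match_positions_Cons sum.reindex)

lemma arrivals_Nil [simp]: "arrivals [] = []"
  by (simp add: arrivals_def map_filter_simps)

lemma arrivals_Cons [simp]:
  "arrivals ((u, Arrival i) # es) = (u, i) # arrivals es"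
  "arrivals ((u, Match) # es) = arrivals es"
  by (simp_all add: arrivals_def map_filter_simps)

lemma valid_run_iff:
  "valid_run t x es \<longleftrightarrow> sorted (map fst es) \<and> (\<forall>e\<in>set es. t \<le> fst e) \<and>
     (\<forall>j\<in>match_positions es. final_state x (take j es) \<in> feasible_states)"
proof (induction t x es rule: valid_run.induct)
  case (2 t x u a es)
  have "(\<forall>j\<in>match_positions ((u, a) # es). final_state x (take j ((u, a) # es)) \<in> feasible_states)
      \<longleftrightarrow> (a = Match \<longrightarrow> x \<in> feasible_states) \<and>
        (\<forall>j\<in>match_positions es. final_state (act a x) (take j es) \<in> feasible_states)"
    by (auto simp: match_positions_Cons)
  with 2 show ?case by (auto dest: order_trans)
qed simp

lemma offline_trajectory_iff:
  "offline_trajectory arr es \<longleftrightarrow> valid_run 0 (\<lambda>_. 0) es \<and> arrivals es = arr"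
  by (auto simp: offline_trajectory_def valid_run_iff state_after_def)

lemma final_state_balance:
  "valid_run t x es \<Longrightarrow> final_state x es i + card (match_positions es)
     = x i + length (filter (\<lambda>a. snd a = i) (arrivals es))"
proof (induction t x es rule: valid_run.induct)
  case (2 t x u a es)
  show ?case
  proof (cases a)
    case (Arrival k)
    moreover have "add_agent k x i = x i + (if k = i then 1 else 0)"
      by (simp add: add_agent_def)
    ultimately show ?thesis using 2 by (auto simp: card_match_positions_Cons)
  next
    case Match
    \<comment> \<open>Feasibility keeps the natural-number subtraction in
      \<open>remove_tuple\<close> from truncating.\<close>
    with 2 have "1 \<le> x i" by (simp add: feasible_states_def)
    with 2 Match show ?thesis by (simp add: card_match_positions_Cons remove_tuple_def)
  qed
qed simp

section \<open>Agreement of the integral cost with the recursive cost\<close>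

lemma waiting_rate_0 [simp]: "waiting_rate c (\<lambda>_. 0) = 0"
  by (simp add: waiting_rate_def)

text \<open>The state is constant up to the first event, which the induction splits off. Because the
  run ends empty, the stretch from its last event to \<open>T\<close> is free.\<close>

lemma run_cost_eq:
  assumes "valid_run t x es" "final_state x es = (\<lambda>_. 0)" "\<forall>e\<in>set es. fst e \<le> T" "t \<le> T"
  shows "\<exists>I. ((\<lambda>s. waiting_rate c (final_state x (filter (\<lambda>e. fst e \<le> s) es))) has_integral I) {t..T}
    \<and> I + (\<Sum>j\<in>match_positions es. f (final_state x (take j es))) = run_cost c f t x es"
  using assms
proof (induction t x es rule: valid_run.induct)
  case (1 t x)
  then show ?case by (auto intro!: exI[of _ 0])
next
  case (2 t x u a es)
  let ?g = "\<lambda>x es s. waiting_rate c (final_state x (filter (\<lambda>e. fst e \<le> s) es))"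
  from 2 obtain I where I: "(?g (act a x) es has_integral I) {u..T}"
    "I + (\<Sum>j\<in>match_positions es. f (final_state (act a x) (take j es)))
       = run_cost c f u (act a x) es"
    by auto
  have tu: "t \<le> u" "u \<le> T" and later: "\<forall>e\<in>set es. u \<le> fst e"
    using "2.prems" by (auto simp: valid_run_iff)
  have "((\<lambda>_. waiting_rate c x) has_integral (u - t) *\<^sub>R waiting_rate c x) {t..u}"
    using has_integral_const_real[of "waiting_rate c x" t u] tu by simp
  then have first: "(?g x ((u, a) # es) has_integral (u - t) *\<^sub>R waiting_rate c x) {t..u}"
  \<comment> \<open>At time \<open>u\<close> itself the event has already taken effect, so the
    integrand may differ from the constant at this one point.\<close>
  proof (rule has_integral_spike_finite[of "{u}", rotated 2])
    fix s assume "s \<in> {t..u} - {u}"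
    then have "filter (\<lambda>e. fst e \<le> s) ((u, a) # es) = []"
      using later by (auto simp: filter_empty_conv)
    then show "?g x ((u, a) # es) s = waiting_rate c x" by (simp del: filter.simps)
  qed simp
  have "(?g x ((u, a) # es) has_integral I) {u..T}"
    by (rule has_integral_eq[OF _ I(1)]) auto
  with first have "(?g x ((u, a) # es) has_integral ((u - t) *\<^sub>R waiting_rate c x + I)) {t..T}"
    using tu by (intro has_integral_combine)
  then show ?case
    using I(2) by (intro exI[of _ "(u - t) *\<^sub>R waiting_rate c x + I"])
      (auto simp: sum_match_positions_Cons mult.commute)
qed

lemma total_cost_eq_run_cost:
  fixes es :: "'n::finite trajectory"
  assumes valid: "valid_run 0 (\<lambda>_. 0) es" and final: "final_state (\<lambda>_. 0) es = (\<lambda>_. 0)"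
    and card: "card (match_positions es) = K"
  shows "total_cost c f K es = ereal (run_cost c f 0 (\<lambda>_. 0) es)"
proof -
  let ?T = "last_match_time es"
  have late: "(\<forall>e\<in>set es. fst e \<le> ?T) \<and> 0 \<le> ?T"
  proof (cases es rule: rev_cases)
    case Nil
    then show ?thesis by (simp add: last_match_time_def)
  next
    case (snoc es' e)
    \<comment> \<open>A final arrival would leave an agent behind. So the last event is a match and
      \<open>last_match_time\<close> bounds all event times.\<close>
    have "snd e = Match"
    proof (cases "snd e")
      case (Arrival i)
      then have "final_state (\<lambda>_. 0) es i \<noteq> 0" by (simp add: snoc add_agent_def)
      with final show ?thesis by simp
    qed
    then have "length es' \<in> match_positions es" by (simp add: snoc match_positions_def)
    moreover have "\<And>j. j \<in> match_positions es \<Longrightarrow> j \<le> length es'"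
      by (auto simp: snoc match_positions_def)
    ultimately have "Max (match_positions es) = length es'" "match_positions es \<noteq> {}"
      by (auto intro: Max_eqI)
    then have "?T = fst e" by (simp add: last_match_time_def snoc)
    then show ?thesis using valid by (auto simp: snoc valid_run_iff sorted_append)
  qed
  obtain I where "((\<lambda>t. waiting_rate c (state_at es t)) has_integral I) {0..?T}"
    "I + (\<Sum>j\<in>match_positions es. f (state_after (take j es))) = run_cost c f 0 (\<lambda>_. 0) es"
    using run_cost_eq[OF valid final, of ?T c f] late
    by (auto simp: state_at_def state_after_def)
  then show ?thesis using card by (simp add: total_cost_def integral_unique)
qed

section \<open>The cost-balancing run against an offline run\<close>

locale matching_costs =
  fixes c :: "'n::finite \<Rightarrow> real" and f :: "'n state \<Rightarrow> real" and \<alpha> :: real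
  assumes c_pos: "\<And>i. 0 < c i"
    and f_nonneg: "\<And>x. 0 \<le> f x"
    and f_antimono: "\<And>x y. x \<in> feasible_states \<Longrightarrow> y \<in> feasible_states \<Longrightarrow> y \<le> x \<Longrightarrow> f x \<le> f y"
    and \<alpha>_pos: "0 < \<alpha>"
begin

section \<open>Waiting rates and timer expiry\<close>

lemma waiting_rate_mono: "x \<le> y \<Longrightarrow> waiting_rate c x \<le> waiting_rate c y"
  unfolding waiting_rate_def
  by (intro sum_mono mult_left_mono) (auto simp: le_fun_def less_imp_le c_pos)

lemma waiting_rate_nonneg: "0 \<le> waiting_rate c x"
  unfolding waiting_rate_def by (intro sum_nonneg) (simp add: less_imp_le c_pos)

lemma waiting_rate_pos: "x \<in> feasible_states \<Longrightarrow> 0 < waiting_rate c x"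
  unfolding waiting_rate_def
  by (intro sum_pos) (auto simp: feasible_states_def c_pos Suc_le_eq)

definition expiry :: "real \<Rightarrow> real \<Rightarrow> 'n state \<Rightarrow> real" where
  "expiry t W x = t + (f x / \<alpha> - W) / waiting_rate c x"

text \<open>Since the rate is positive, comparing a time with the expiry amounts to comparing
  \<open>f x\<close> with \<alpha> times the waiting cost accumulated by then.\<close>

lemma le_expiry_iff:
  assumes "x \<in> feasible_states"
  shows "v \<le> expiry t W x \<longleftrightarrow> \<alpha> * (W + waiting_rate c x * (v - t)) \<le> f x"
  using waiting_rate_pos[OF assms] \<alpha>_pos
  by (simp add: expiry_def field_simps)

lemma expiry_le_iff:
  assumes "x \<in> feasible_states"
  shows "expiry t W x \<le> v \<longleftrightarrow> f x \<le> \<alpha> * (W + waiting_rate c x * (v - t))"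
  using waiting_rate_pos[OF assms] \<alpha>_pos
  by (simp add: expiry_def field_simps)

lemma expiry_advance:
  assumes "x \<in> feasible_states"
  shows "expiry v (W + waiting_rate c x * (v - t)) x = expiry t W x"
  using waiting_rate_pos[OF assms] by (simp add: expiry_def field_simps)

section \<open>Unfolding the cost-balancing algorithm\<close>

lemma cb_match:
  "x \<in> feasible_states \<Longrightarrow> f x \<le> \<alpha> * W \<Longrightarrow>
     cb_from c f \<alpha> t W x arr = (t, Match) # cb_from c f \<alpha> t 0 (remove_tuple x) arr"
  by (subst cb_from.simps) simp

lemma cb_timer:
  assumes "x \<in> feasible_states" "\<not> f x \<le> \<alpha> * W" "arr \<noteq> [] \<Longrightarrow> expiry t W x \<le> fst (hd arr)"
  shows "cb_from c f \<alpha> t W x arr =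
    (expiry t W x, Match) # cb_from c f \<alpha> (expiry t W x) 0 (remove_tuple x) arr"
  using assms
  by (subst cb_from.simps) (auto simp: Let_def expiry_def split: list.split)

lemma cb_arrival:
  assumes "x \<in> feasible_states \<Longrightarrow> \<not> f x \<le> \<alpha> * W \<and> u < expiry t W x"
  shows "cb_from c f \<alpha> t W x ((u, i) # arr) =
    (u, Arrival i) # cb_from c f \<alpha> u (W + waiting_rate c x * (u - t)) (add_agent i x) arr"
  using assms
  by (subst cb_from.simps) (auto simp: Let_def expiry_def)

lemma cb_stop: "x \<notin> feasible_states \<Longrightarrow> cb_from c f \<alpha> t W x [] = []"
  by (subst cb_from.simps) simp

text \<open>This allows a stop at offline matches, which the algorithm does not see: resuming there
  with the updated \<open>W\<close> leaves the expiry time, and hence the run, unchanged.\<close>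

lemma cb_advance:
  assumes "t \<le> v" "arr \<noteq> [] \<Longrightarrow> v \<le> fst (hd arr)"
    and pending: "x \<in> feasible_states \<Longrightarrow> \<not> f x \<le> \<alpha> * W \<and> v \<le> expiry t W x"
  shows "cb_from c f \<alpha> v (W + waiting_rate c x * (v - t)) x arr = cb_from c f \<alpha> t W x arr"
    (is "cb_from c f \<alpha> v ?W x arr = _")
proof (cases "x \<in> feasible_states \<and> (arr \<noteq> [] \<longrightarrow> expiry t W x \<le> fst (hd arr))")
  case True
  then have x: "x \<in> feasible_states" by simp
  have *: "cb_from c f \<alpha> t W x arr =
      (expiry t W x, Match) # cb_from c f \<alpha> (expiry t W x) 0 (remove_tuple x) arr"
    using True pending by (intro cb_timer) auto
  show ?thesis
  proof (cases "v = expiry t W x")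
    case True
    \<comment> \<open>Resumed exactly at expiry, the algorithm matches at once instead of by timer;
      the event is the same.\<close>
    then show ?thesis using * x by (simp add: cb_match flip: expiry_le_iff)
  next
    case False
    then have "\<not> f x \<le> \<alpha> * ?W" using pending x by (simp flip: expiry_le_iff)
    then show ?thesis
      using * x True by (subst cb_timer) (auto simp: expiry_advance)
  qed
next
  case False
  show ?thesis
  proof (cases arr)
    case Nil
    then show ?thesis using False by (simp add: cb_stop)
  next
    case (Cons a arr')
    obtain u i where a: "a = (u, i)" by fastforce
    have late: "x \<in> feasible_states \<Longrightarrow> v \<le> u \<and> u < expiry t W x"
      using False assms by (auto simp: Cons a)
    have "\<not> f x \<le> \<alpha> * ?W \<and> u < expiry v ?W x" if "x \<in> feasible_states"
      using late[OF that] that expiry_le_iff[OF that, of t W v] by (simp add: expiry_advance)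
    moreover have "?W + waiting_rate c x * (u - v) = W + waiting_rate c x * (u - t)"
      by (simp add: algebra_simps)
    moreover have "\<not> f x \<le> \<alpha> * W \<and> u < expiry t W x" if "x \<in> feasible_states"
      using late[OF that] pending[OF that] by simp
    ultimately show ?thesis
      unfolding Cons a by (metis cb_arrival)
  qed
qed

text \<open>The measure is that of the termination proof: an arrival takes 2 from the list part and
  adds one agent, and a match removes agents.\<close>

lemma cb_run:
  assumes "sorted (map fst arr)" "\<forall>a\<in>set arr. t \<le> fst a"
  shows "valid_run t x (cb_from c f \<alpha> t W x arr) \<and> arrivals (cb_from c f \<alpha> t W x arr) = arr
    \<and> final_state x (cb_from c f \<alpha> t W x arr) \<notin> feasible_states"
  using assms
proof (induction "2 * length arr + sum x UNIV" arbitrary: t W x arr rule: less_induct)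
  case less
  let ?now = "x \<in> feasible_states \<and> f x \<le> \<alpha> * W"
  let ?timer = "x \<in> feasible_states \<and> \<not> f x \<le> \<alpha> * W \<and> (arr \<noteq> [] \<longrightarrow> expiry t W x \<le> fst (hd arr))"
  consider ?now | ?timer | "\<not> ?now" "\<not> ?timer" "arr = []"
    | u i arr' where "\<not> ?now" "\<not> ?timer" "arr = (u, i) # arr'"
    by (metis list.exhaust surj_pair)
  then show ?case
  proof cases
    case 1
    then show ?thesis
      using less.hyps[of arr "remove_tuple x" t 0] less.prems sum_remove_tuple[of x]
      by (simp add: cb_match)
  next
    case 2
    have "t \<le> expiry t W x" using 2 by (simp add: le_expiry_iff)
    moreover have "\<forall>a\<in>set arr. expiry t W x \<le> fst a"
      using 2 less.prems(1) by (cases arr) auto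
    ultimately show ?thesis
      using 2 less.hyps[of arr "remove_tuple x" "expiry t W x" 0] less.prems sum_remove_tuple[of x]
      by (simp add: cb_timer)
  next
    case 3
    then show ?thesis by (auto simp: cb_stop)
  next
    case (4 u i arr')
    then have "cb_from c f \<alpha> t W x arr =
        (u, Arrival i) # cb_from c f \<alpha> u (W + waiting_rate c x * (u - t)) (add_agent i x) arr'"
      by (auto intro!: cb_arrival)
    then show ?thesis
      using 4 less.hyps[of arr' "add_agent i x" u "W + waiting_rate c x * (u - t)"] less.prems
      by (simp add: sum_add_agent)
  qed
qed

section \<open>Coupling of the two runs and the charging inequality\<close>

lemma run_cost_le_advance: "t \<le> v \<Longrightarrow>
  run_cost c f t x es \<le> waiting_rate c x * (v - t) + run_cost c f v x es"
  by (cases es) (auto simp: waiting_rate_nonneg right_diff_distrib mult_left_mono)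

text \<open>A further event is what charges the wait; a finished run costs nothing, so in general
  only the inequality holds.\<close>

lemma run_cost_advance: "es \<noteq> [] \<Longrightarrow>
  run_cost c f t x es = waiting_rate c x * (v - t) + run_cost c f v x es"
  by (cases es) (auto simp: algebra_simps)

text \<open>
  \<open>x\<close> is the state of the cost-balancing run, \<open>y\<close> that of the offline run, whose remaining events are
  \<open>es\<close>, and \<open>F\<close> lists the costs of those offline matches whose counterparts are still to come
  in the cost-balancing run.
\<close>

definition coupled :: "real \<Rightarrow> real \<Rightarrow> 'n state \<Rightarrow> 'n state \<Rightarrow> 'n trajectory \<Rightarrow> real list \<Rightarrow> bool" where
  "coupled t W x y es F \<longleftrightarrow>
     valid_run t y es \<and> final_state y es = (\<lambda>_. 0) \<and> 0 \<le> W \<and>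
     (if F = [] then \<exists>d. y = (\<lambda>i. x i + d)
      else \<alpha> * W \<le> hd F \<and> x = (\<lambda>i. y i + length F)) \<and>
     (\<forall>j<length F. f (\<lambda>i. x i - j) \<le> F ! j)"

text \<open>The left \<open>W\<close> is the cost of the current cycle incurred so far. The last
  summand is the offline credit for it: waiting cost already paid while \<open>F\<close> is empty,
  otherwise the stored match costs.\<close>

definition bounded_by :: "real \<Rightarrow> real \<Rightarrow> real \<Rightarrow> 'n state \<Rightarrow> 'n state \<Rightarrow> 'n trajectory \<Rightarrow> real list \<Rightarrow> bool" where
  "bounded_by r t W x y es F \<longleftrightarrow>
     run_cost c f t x (cb_from c f \<alpha> t W x (arrivals es)) + W
       \<le> r * (run_cost c f t y es + (if F = [] then W else sum_list F))"

lemma coupled_feasible: "coupled t W x y es F \<Longrightarrow> F \<noteq> [] \<Longrightarrow> x \<in> feasible_states"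
  by (auto simp: coupled_def feasible_states_def Suc_le_eq)

lemma coupled_hd: "coupled t W x y es F \<Longrightarrow> F \<noteq> [] \<Longrightarrow> f x \<le> hd F"
  by (cases F) (auto simp: coupled_def dest: spec[of _ 0])

text \<open>Up to the expiry, \<alpha> times the new \<open>W\<close> is at most \<open>f x\<close>,
  which the head of \<open>F\<close> dominates.\<close>

lemma coupled_advance:
  assumes coupled: "coupled t W x y es F"
    and v: "t \<le> v" "es \<noteq> [] \<Longrightarrow> v \<le> fst (hd es)"
    and pending: "x \<in> feasible_states \<Longrightarrow> \<not> f x \<le> \<alpha> * W \<and> v \<le> expiry t W x"
  shows "coupled v (W + waiting_rate c x * (v - t)) x y es F"
proof -
  have "valid_run v y es"
    using coupled v(2) by (cases es) (auto simp: coupled_def)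
  moreover have "\<alpha> * (W + waiting_rate c x * (v - t)) \<le> hd F" if "F \<noteq> []"
    using pending coupled_feasible[OF coupled that] coupled_hd[OF coupled that] le_expiry_iff[of x v t W]
    by auto
  ultimately show ?thesis
    using coupled v(1) waiting_rate_nonneg[of x] by (auto simp: coupled_def)
qed

lemma hd_arrivals:
  assumes "valid_run v y es" "arrivals es \<noteq> []"
  shows "v \<le> fst (hd (arrivals es))"
  using assms
proof (induction v y es rule: valid_run.induct)
  case (2 t x u a es)
  then show ?case by (cases a) auto
qed simp

text \<open>On the left, the wait until \<open>v\<close> is exactly the growth of \<open>W\<close>.
  On the right, if \<open>F\<close> is empty then \<open>x \<le> y\<close> and the offline waiting
  cost covers that growth; otherwise the credit is unchanged and offline waiting is dropped.
  \<open>nonempty\<close> excludes the case in which no offline event charges the wait and no stored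
  cost replaces it.\<close>

lemma bounded_by_advance:
  assumes coupled: "coupled t W x y es F"
    and v: "t \<le> v" "es \<noteq> [] \<Longrightarrow> v \<le> fst (hd es)"
    and pending: "x \<in> feasible_states \<Longrightarrow> \<not> f x \<le> \<alpha> * W \<and> v \<le> expiry t W x"
    and r: "0 \<le> r" and nonempty: "es \<noteq> [] \<or> F \<noteq> []"
    and bound: "bounded_by r v (W + waiting_rate c x * (v - t)) x y es F"
  shows "bounded_by r t W x y es F"
proof -
  let ?W = "W + waiting_rate c x * (v - t)"
  have "valid_run v y es"
    using coupled_advance[OF coupled v pending] by (simp add: coupled_def)
  then have "cb_from c f \<alpha> v ?W x (arrivals es) = cb_from c f \<alpha> t W x (arrivals es)"
    by (intro cb_advance v pending hd_arrivals)
  then have 1: "run_cost c f t x (cb_from c f \<alpha> t W x (arrivals es)) + W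
      \<le> r * (run_cost c f v y es + (if F = [] then ?W else sum_list F))"
    using bound run_cost_le_advance[OF v(1), of x "cb_from c f \<alpha> t W x (arrivals es)"]
    by (simp add: bounded_by_def)
  have "run_cost c f v y es + (if F = [] then ?W else sum_list F)
      \<le> run_cost c f t y es + (if F = [] then W else sum_list F)"
  proof (cases "F = []")
    case True
    then have "x \<le> y" using coupled by (auto simp: coupled_def le_fun_def)
    then have "waiting_rate c x * (v - t) \<le> waiting_rate c y * (v - t)"
      using v(1) by (intro mult_right_mono waiting_rate_mono) auto
    then show ?thesis using True nonempty run_cost_advance[of es t y v] by simp
  next
    case False
    have "0 \<le> waiting_rate c y * (v - t)" using waiting_rate_nonneg v(1) by simp
    then show ?thesis using False run_cost_advance[of es t y v] by (cases "es = []") auto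
  qed
  from mult_left_mono[OF this r] 1 show ?thesis by (simp add: bounded_by_def)
qed

text \<open>One event due now is processed; a due cost-balancing match precedes offline events at
  the same time. The induction hypothesis is the assumption \<open>IH\<close>, whose measure ignores
  time, so a caller may move the clock first.\<close>

lemma bounded_by_ready:
  assumes r: "1 + \<alpha> \<le> r" "1 + 1 / \<alpha> \<le> r"
    and IH: "\<And>t W x' y es' F. 2 * length es' + sum x' UNIV < 2 * length es + sum x UNIV \<Longrightarrow>
      coupled t W x' y es' F \<Longrightarrow> bounded_by r t W x' y es' F"
    and coupled: "coupled t W x y es F"
    and ready: "(x \<in> feasible_states \<and> f x \<le> \<alpha> * W) \<or> (es \<noteq> [] \<and> fst (hd es) = t)"
  shows "bounded_by r t W x y es F"
proof (cases "x \<in> feasible_states \<and> f x \<le> \<alpha> * W")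
  case True
  have W: "0 \<le> W" using coupled by (simp add: coupled_def)
  have "coupled t 0 (remove_tuple x) y es (tl F)"
  proof (cases F)
    case Nil
    then obtain d where d: "y = (\<lambda>i. x i + d)" using coupled by (auto simp: coupled_def)
    \<comment> \<open>The offline run falls one more match behind.\<close>
    have "y i = remove_tuple x i + Suc d" for i
      using remove_tuple_Suc[of x i] True by (simp add: d)
    then have "\<exists>d. y = (\<lambda>i. remove_tuple x i + d)" by blast
    then show ?thesis using coupled Nil by (simp add: coupled_def)
  next
    case (Cons a F')
    have bank: "f (\<lambda>i. remove_tuple x i - j) \<le> F' ! j" if "j < length F'" for j
    proof -
      have "f (\<lambda>i. x i - Suc j) \<le> F ! Suc j"
        using coupled that Cons by (auto simp: coupled_def)
      then show ?thesis by (simp add: Cons remove_tuple_def)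
    qed
    \<comment> \<open>With \<open>W\<close> reset to 0, the invariant only asks the new head to be
      nonnegative. If nothing remains stored, the runs are level, with offset 0.\<close>
    moreover have "0 \<le> hd F'" if "F' \<noteq> []"
      using bank[of 0] that f_nonneg[of "\<lambda>i. remove_tuple x i"] by (cases F') auto
    ultimately show ?thesis
      using coupled Cons by (auto simp: coupled_def remove_tuple_def intro!: exI[of _ 0])
  qed
  then have "bounded_by r t 0 (remove_tuple x) y es (tl F)"
    using True sum_remove_tuple by (intro IH) auto
  then have rest: "run_cost c f t (remove_tuple x) (cb_from c f \<alpha> t 0 (remove_tuple x) (arrivals es))
      \<le> r * (run_cost c f t y es + sum_list (tl F))"
    by (auto simp: bounded_by_def split: if_splits)
  \<comment> \<open>The charge for the finished cycle: to offline waiting if \<open>F\<close> is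
    empty, to the oldest stored match otherwise.\<close>
  have "f x + W \<le> r * (if F = [] then W else hd F)"
  proof (cases "F = []")
    case True
    have "f x + W \<le> (1 + \<alpha>) * W" using \<open>_ \<and> _\<close> by (simp add: algebra_simps)
    also have "\<dots> \<le> r * W" using r W by (intro mult_right_mono)
    finally show ?thesis using True by simp
  next
    case False
    have "\<alpha> * W \<le> hd F" "f x \<le> hd F"
      using coupled False coupled_hd[OF coupled] by (auto simp: coupled_def)
    moreover from this have "W \<le> hd F / \<alpha>" using \<alpha>_pos by (simp add: field_simps)
    ultimately have "f x + W \<le> (1 + 1 / \<alpha>) * hd F" by (simp add: distrib_right)
    also have "\<dots> \<le> r * hd F"
      using r \<open>f x \<le> hd F\<close> f_nonneg[of x] by (intro mult_right_mono) auto
    finally show ?thesis using False by simp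
  qed
  with rest show ?thesis
    using True by (cases F) (auto simp: bounded_by_def cb_match algebra_simps)
next
  case False
  then obtain a es' where es: "es = (t, a) # es'"
    using ready by (cases es) auto
  have r0: "0 \<le> r" using r \<alpha>_pos by linarith
  show ?thesis
  proof (cases a)
    case (Arrival i)
    \<comment> \<open>An arrival can only lower the costs of outstanding matches;
      \<open>j < length F\<close> keeps both states feasible, as antitonicity requires.\<close>
    have mono: "f (\<lambda>k. add_agent i x k - j) \<le> F ! j" if "j < length F" for j
    proof -
      have "x = (\<lambda>i. y i + length F)"
        using coupled that by (auto simp: coupled_def split: if_splits)
      then have "f (\<lambda>k. add_agent i x k - j) \<le> f (\<lambda>k. x k - j)"
        using that by (intro f_antimono) (auto simp: feasible_states_def add_agent_def le_fun_def)
      also have "\<dots> \<le> F ! j" using coupled that by (simp add: coupled_def)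
      finally show ?thesis .
    qed
    have "add_agent i (\<lambda>k. z k + d) = (\<lambda>k. add_agent i z k + d)" for z :: "'n state" and d
      by (auto simp: add_agent_def)
    then have "coupled t W (add_agent i x) (add_agent i y) es' F"
      using coupled mono by (auto simp: coupled_def es Arrival) (rule exI, rule refl)
    then have "bounded_by r t W (add_agent i x) (add_agent i y) es' F"
      by (intro IH) (auto simp: es sum_add_agent)
    moreover have "x \<in> feasible_states \<Longrightarrow> \<not> f x \<le> \<alpha> * W \<and> t < expiry t W x"
      using False expiry_le_iff[of x t W t] by auto
    ultimately show ?thesis by (simp add: bounded_by_def es Arrival cb_arrival)
  next
    case Match
    have y: "y \<in> feasible_states" and W: "0 \<le> W"
      using coupled by (auto simp: coupled_def es Match)
    have y_eq: "y = (\<lambda>i. remove_tuple y i + 1)"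
      using remove_tuple_Suc[OF y] by simp
    show ?thesis
    proof (cases "F = [] \<and> y \<noteq> x")
      case True
      \<comment> \<open>The offline run is strictly behind and catches up by one match, whose cost
        is dropped.\<close>
      then obtain d where d: "y = (\<lambda>i. x i + d)" using coupled by (auto simp: coupled_def)
      then have "d \<noteq> 0" using True by auto
      then have "remove_tuple y = (\<lambda>i. x i + (d - 1))" using d by (auto simp: remove_tuple_def)
      then have "coupled t W x (remove_tuple y) es' []"
        using coupled True by (auto simp: coupled_def es Match)
      then have "bounded_by r t W x (remove_tuple y) es' []"
        by (intro IH) (auto simp: es)
      moreover have "0 \<le> r * f y" using r0 f_nonneg by simp
      ultimately show ?thesis
        using True by (simp add: bounded_by_def es Match algebra_simps)
    next
      case False
      then have "x = (\<lambda>i. y i + length F)" using coupled by (auto simp: coupled_def split: if_splits)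
      \<comment> \<open>The offline run is level or ahead, so the cost of its match is stored. The
        new entry, at index \<open>length F\<close>, satisfies its bound with equality.\<close>
      then have x_eq: "x = (\<lambda>i. remove_tuple y i + length (F @ [f y]))"
        and last: "y = (\<lambda>i. x i - length F)"
        using y_eq by (auto simp: fun_eq_iff)
      \<comment> \<open>If the list was empty, then \<open>x = y\<close> is feasible with no match
        due, so \<alpha> times \<open>W\<close> is below \<open>f x\<close>.\<close>
      have "\<alpha> * W \<le> hd (F @ [f y])"
      proof (cases "F = []")
        case True
        with False have "y = x" by simp
        with y \<open>\<not> (x \<in> feasible_states \<and> f x \<le> \<alpha> * W)\<close> True show ?thesis by auto
      qed (use coupled in \<open>auto simp: coupled_def\<close>)
      moreover have "f (\<lambda>i. x i - j) \<le> (F @ [f y]) ! j" if "j < length (F @ [f y])" for j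
        using that coupled last by (auto simp: coupled_def nth_append less_Suc_eq)
      ultimately have "coupled t W x (remove_tuple y) es' (F @ [f y])"
        using coupled x_eq by (simp add: coupled_def es Match)
      then have "bounded_by r t W x (remove_tuple y) es' (F @ [f y])"
        by (intro IH) (auto simp: es)
      moreover have "0 \<le> r * W" using r0 W by simp
      ultimately show ?thesis
        by (auto simp: bounded_by_def es Match algebra_simps)
    qed
  qed
qed

text \<open>The clock jumps to \<open>v\<close>, the earlier of the timer (if \<open>x\<close> is
  feasible) and the next offline event. That event is processed there, and
  \<open>bounded_by_advance\<close> carries the bound back to \<open>t\<close>.\<close>

lemma coupled_bounded_by:
  assumes r: "1 + \<alpha> \<le> r" "1 + 1 / \<alpha> \<le> r" and "coupled t W x y es F"
  shows "bounded_by r t W x y es F"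
  using assms(3)
proof (induction "2 * length es + sum x UNIV" arbitrary: t W x y es F rule: less_induct)
  case less
  note coupled = less.prems
  have r1: "1 \<le> r" using r \<alpha>_pos by linarith
  let ?ready = "\<lambda>t W. (x \<in> feasible_states \<and> f x \<le> \<alpha> * W) \<or> (es \<noteq> [] \<and> fst (hd es) = t)"
  have ready: "bounded_by r s V x y es F" if "coupled s V x y es F" "?ready s V" for s V
    by (rule bounded_by_ready[OF r _ that]) (rule less.hyps)
  show ?case
  proof (cases "(x \<in> feasible_states \<and> f x \<le> \<alpha> * W) \<or> (es = [] \<and> F = [])")
    case True
    show ?thesis
    proof (cases "x \<in> feasible_states \<and> f x \<le> \<alpha> * W")
      case True
      then show ?thesis using ready[OF coupled] by simp
    next
      case False
      with True have E: "es = []" "F = []" by auto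
      \<comment> \<open>The offline run is over, empty and not ahead, so \<open>x\<close> is empty
        too and only \<open>W \<le> r * W\<close> remains.\<close>
      then have "x = (\<lambda>_. 0)" "0 \<le> W" using coupled by (auto simp: coupled_def fun_eq_iff)
      then show ?thesis
        using E r1 mult_right_mono[of 1 r W] by (simp add: bounded_by_def cb_stop feasible_states_def)
    qed
  next
    case False
    define v where "v = (if es = [] then expiry t W x
      else if x \<in> feasible_states then min (expiry t W x) (fst (hd es)) else fst (hd es))"
    \<comment> \<open>An offline run that is over but ahead leaves stored costs, hence complete
      tuples in \<open>x\<close> and a running timer.\<close>
    have feas: "x \<in> feasible_states" if "es = []"
      using False that coupled_feasible[OF coupled] by auto
    have "t \<le> fst (hd es)" if "es \<noteq> []"
      using coupled that by (cases es) (auto simp: coupled_def)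
    moreover have "t \<le> expiry t W x" if "x \<in> feasible_states"
      using False that by (simp add: le_expiry_iff)
    ultimately have v: "t \<le> v" "es \<noteq> [] \<Longrightarrow> v \<le> fst (hd es)"
      using feas by (auto simp: v_def)
    have pending: "\<not> f x \<le> \<alpha> * W \<and> v \<le> expiry t W x" if "x \<in> feasible_states"
      using False that by (auto simp: v_def)
    have "?ready v (W + waiting_rate c x * (v - t))"
      using feas expiry_le_iff[of x t W v] by (auto simp: v_def min_def)
    then have "bounded_by r v (W + waiting_rate c x * (v - t)) x y es F"
      by (intro ready coupled_advance[OF coupled v pending])
    then show ?thesis
      using False r1 by (intro bounded_by_advance[OF coupled v pending]) auto
  qed
qed

section \<open>Balanced instances and the competitive ratio\<close>

lemma balanced_final_state:
  assumes "balanced_instance K arr" "valid_run 0 (\<lambda>_. 0) es" "arrivals es = arr"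
  shows "final_state (\<lambda>_. 0) es i + card (match_positions es) = K"
  using final_state_balance[OF assms(2), of i] assms(1,3) by (simp add: balanced_instance_def)

lemma cost_balancing_competitive:
  assumes bal: "balanced_instance K arr" and r: "1 + \<alpha> \<le> r" "1 + 1 / \<alpha> \<le> r"
  shows "total_cost c f K (cost_balancing c f \<alpha> arr) \<le> ereal r * opt_cost c f K arr"
proof -
  have r0: "0 < r" using r \<alpha>_pos by linarith
  let ?cb = "cost_balancing c f \<alpha> arr"
  have cb: "valid_run 0 (\<lambda>_. 0) ?cb" "arrivals ?cb = arr" "final_state (\<lambda>_. 0) ?cb \<notin> feasible_states"
    using cb_run[of arr 0 "\<lambda>_. 0" 0] bal by (auto simp: cost_balancing_def balanced_instance_def)
  note bal_cb = balanced_final_state[OF bal cb(1,2)]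
  \<comment> \<open>One exhausted type forces \<open>K\<close> matches, and then balance exhausts
    every type.\<close>
  obtain i where "final_state (\<lambda>_. 0) ?cb i = 0"
    using cb(3) by (auto simp: feasible_states_def not_less_eq_eq)
  then have "card (match_positions ?cb) = K" using bal_cb[of i] by simp
  then have cost_cb: "total_cost c f K ?cb = ereal (run_cost c f 0 (\<lambda>_. 0) ?cb)"
    using bal_cb by (intro total_cost_eq_run_cost[OF cb(1)]) (auto simp: fun_eq_iff)
  \<comment> \<open>Dividing by \<open>r\<close> gives a lower bound for each offline run
    separately, as the infimum needs.\<close>
  have "total_cost c f K ?cb / ereal r \<le> total_cost c f K es" if "offline_trajectory arr es" for es
  proof (cases "card (match_positions es) = K")
    case True
    have es: "valid_run 0 (\<lambda>_. 0) es" "arrivals es = arr"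
      using that by (auto simp: offline_trajectory_iff)
    have final: "final_state (\<lambda>_. 0) es = (\<lambda>_. 0)"
      using balanced_final_state[OF bal es] True by (auto simp: fun_eq_iff)
    \<comment> \<open>The runs start level with \<open>W = 0\<close>, where
      \<open>bounded_by\<close> is the claimed inequality.\<close>
    have "coupled 0 0 (\<lambda>_. 0) (\<lambda>_. 0) es []"
      using es final by (auto simp: coupled_def)
    from coupled_bounded_by[OF r this]
    have "run_cost c f 0 (\<lambda>_. 0) ?cb \<le> r * run_cost c f 0 (\<lambda>_. 0) es"
      by (simp add: bounded_by_def es cost_balancing_def)
    then show ?thesis
      using total_cost_eq_run_cost[OF es(1) final True] cost_cb r0 by (simp add: field_simps)
  next
    case False
    then show ?thesis by (simp add: total_cost_def)
  qed
  then have "total_cost c f K ?cb / ereal r \<le> opt_cost c f K arr"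
    unfolding opt_cost_def by (auto intro: INF_greatest)
  then show ?thesis using r0 by (subst (asm) ereal_divide_le_pos) auto
qed

end

theorem theorem1:
  fixes c :: "'n::finite \<Rightarrow> real"
    and f :: "'n state \<Rightarrow> real"
    and K :: nat
    and arr :: "'n arrival_seq"
  assumes "2 \<le> CARD('n)"
    and "\<And>i. 0 < c i"
    and "\<And>x. 0 \<le> f x"
    and "\<And>x. x \<in> feasible_states \<Longrightarrow> 0 < f x"
    and "\<And>x y. x \<in> feasible_states \<Longrightarrow> y \<in> feasible_states \<Longrightarrow> y \<le> x \<Longrightarrow> f x \<le> f y"
    and "balanced_instance K arr"
  shows "(\<forall>\<alpha>>0. total_cost c f K (cost_balancing c f \<alpha> arr)
                  \<le> ereal (1 + max \<alpha> (1 / \<alpha>)) * opt_cost c f K arr)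
         \<and> total_cost c f K (cost_balancing c f 1 arr) \<le> 2 * opt_cost c f K arr"
proof -
  have "total_cost c f K (cost_balancing c f \<alpha> arr) \<le> ereal (1 + max \<alpha> (1 / \<alpha>)) * opt_cost c f K arr"
    if "0 < \<alpha>" for \<alpha>
  proof -
    interpret matching_costs c f \<alpha>
      using assms(2,3,5) that by unfold_locales
    show ?thesis using assms(6) by (intro cost_balancing_competitive) auto
  qed
  from this this[of 1] show ?thesis by simp
qed

end
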